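(* Let $F_2$ be a non-empty finite subset of $\mathbb{Z}^2$. Let $F_1$ be a uniquely determined neighbour of $F_2$. Put $\alpha = \alpha(F_2, F_1)$. Then $$\frac{|F_2 \cap F_1|}{|F_2|} \geq 1 - \frac{\sqrt{2}\, \alpha}{\sqrt{|F_2|}}.$$
   Context: For $F$ a finite subset of $\mathbb{Z}^2$, the row sum of row $i\in\mathbb{Z}$ is the number of $j \in \mathbb{Z}$ with $(i,j)\in F$, and the column sum of column $j\in\mathbb{Z}$ is the number of $i \in \mathbb{Z}$ with $(i,j)\in F$. The row and column sums together are called the line sums of $F$. A finite set $F\subset\mathbb{Z}^2$ is called uniquely determined (by its line sums) if every subset $F'$ of $\mathbb{Z}^2$ with exactly the same row and column sums as $F$ equals $F$. For finite $F, G\subset \mathbb{Z}^2$ with row sums $r_i^{F}, r_i^{G}$ ($i\in\mathbb{Z}$) and column sums $c_j^{F}, c_j^{G}$ ($j\in\mathbb{Z}$), define $$\alpha(F,G)=\frac12\Big(\sum_{j\in\mathbb{Z}}|c_j^{F}-c_j^{G}|+\sum_{i\in\mathbb{Z}}|r_i^{F}-r_i^{G}|\Big).$$ Uniquely determined neighbour: let $G$ be a finite subset of $\mathbb{Z}^2$ with column sums $c_j$, and let $C$ be a finite set of $n$ column indices containing every column with non-zero column sum of $G$. A set $F_1$ is a uniquely determined neighbour of $G$ if $F_1$ is a finite uniquely determined set, $F_1$ has the same row sum as $G$ in every row, all columns of $F_1$ with index outside $C$ are empty, and there is an enumeration $\sigma(1),\ldots,\sigma(n)$ of $C$ with $c_{\sigma(1)}\ge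 c_{\sigma(2)}\ge\ldots\ge c_{\sigma(n)}$ such that the column sums $v_j$ of $F_1$ satisfy $v_{\sigma(1)}\ge v_{\sigma(2)}\ge\ldots\ge v_{\sigma(n)}$. (This depends only on the line sums of $G$ and not on the choice of $C$.) *)

theory Defs
  imports "HOL-Analysis.Analysis"
begin

(* Line sums are only meaningful for finite sets, since card is 0 on infinite sets. *)

definition row_sum :: "(int \<times> int) set \<Rightarrow> int \<Rightarrow> nat" where
  "row_sum F i = card {j. (i, j) \<in> F}"

definition col_sum :: "(int \<times> int) set \<Rightarrow> int \<Rightarrow> nat" where
  "col_sum F j = card {i. (i, j) \<in> F}"

(* No competitor is lost by requiring F' to be finite: a set whose line sums genuinely
   agree with those of a finite set has finitely many non-empty rows, each of them finite.
   Without the requirement, an infinite line would count as having line sum 0. *)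
definition uniquely_determined :: "(int \<times> int) set \<Rightarrow> bool" where
  "uniquely_determined F \<longleftrightarrow> finite F \<and>
     (\<forall>F'. finite F' \<and> row_sum F' = row_sum F \<and> col_sum F' = col_sum F \<longrightarrow> F' = F)"

(* For finite F and G both sums have finitely many non-zero terms. *)
definition alpha :: "(int \<times> int) set \<Rightarrow> (int \<times> int) set \<Rightarrow> real" where
  "alpha F G =
     ((\<Sum>\<^sub>\<infinity>j\<in>UNIV. \<bar>real (col_sum F j) - real (col_sum G j)\<bar>)
      + (\<Sum>\<^sub>\<infinity>i\<in>UNIV. \<bar>real (row_sum F i) - real (row_sum G i)\<bar>)) / 2"

(* The notion does not depend on the column set C, which is therefore bound
   existentially; as a hypothesis this covers every admissible C. *)
definition uniquely_determined_neighbour ::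
    "(int \<times> int) set \<Rightarrow> (int \<times> int) set \<Rightarrow> bool" where
  "uniquely_determined_neighbour F1 G \<longleftrightarrow>
     finite G \<and> finite F1 \<and> uniquely_determined F1 \<and> row_sum F1 = row_sum G \<and>
     (\<exists>C \<sigma>. finite C \<and> {j. col_sum G j \<noteq> 0} \<subseteq> C \<and> (\<forall>i j. (i, j) \<in> F1 \<longrightarrow> j \<in> C) \<and>
        bij_betw \<sigma> {1..card C} C \<and>
        antimono_on {1..card C} (\<lambda>k. col_sum G (\<sigma> k)) \<and>
        antimono_on {1..card C} (\<lambda>k. col_sum F1 (\<sigma> k)))"

end

theory Submission
  imports Defs
begin

text \<open>
  In a uniquely determined set \<open>F1\<close> the rows form a chain under inclusion, since otherwise two
  rows admit a switch. Let \<open>M\<close> be the number of distinct non-empty rows of \<open>F1\<close>, and let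
  \<open>\<phi> j\<close> be the number of those that avoid column \<open>j\<close>. In each row \<open>\<phi>\<close> is larger by at least
  one outside \<open>F1\<close> than inside, so, as the row sums agree, the difference of the sums of \<open>\<phi>\<close>
  over \<open>F2\<close> and over \<open>F1\<close> is at least \<open>card (F2 - F1)\<close>. It depends only on the column sums,
  and as \<open>0 \<le> \<phi> \<le> M\<close> it is at most \<open>M * alpha F2 F1\<close>. The distinct non-empty rows have distinct
  positive sizes, whence \<open>M\<^sup>2 \<le> 2 * card F1\<close>.
\<close>

definition row_set :: "(int \<times> int) set \<Rightarrow> int \<Rightarrow> int set" where
  "row_set F i = {j. (i, j) \<in> F}"

lemma row_sum_eq_card_row_set: "row_sum F i = card (row_set F i)"
  by (simp add: row_sum_def row_set_def)

lemma finite_row_set: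
  assumes "finite F"
  shows "finite (row_set F i)"
  by (rule finite_subset[OF _ finite_imageI[OF assms, of snd]]) (force simp: row_set_def)

lemma finite_col:
  assumes "finite (F :: (int \<times> int) set)"
  shows "finite {i. (i, j) \<in> F}"
  by (rule finite_subset[OF _ finite_imageI[OF assms, of fst]]) force

lemma card_switch:
  assumes "finite A" "a \<in> A" "b \<notin> A"
  shows "card (insert b (A - {a})) = card A"
proof -
  have "card (insert b (A - {a})) = Suc (card (A - {a}))"
    using assms by (intro card_insert_disjoint) auto
  then show ?thesis using card_Suc_Diff1[OF assms(1,2)] by simp
qed

lemma uniquely_determined_rows_nested:
  assumes "uniquely_determined F"
  shows "row_set F i \<subseteq> row_set F k \<or> row_set F k \<subseteq> row_set F i"
proof (rule ccontr)
  assume "\<not> ?thesis"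
  then obtain j l where j: "(i, j) \<in> F" "(k, j) \<notin> F" and l: "(k, l) \<in> F" "(i, l) \<notin> F"
    by (auto simp: row_set_def)
  then have ne: "i \<noteq> k" "j \<noteq> l" by auto
  have fin: "finite F" using assms by (simp add: uniquely_determined_def)
  \<comment> \<open>The switch on the rectangle with rows \<open>i\<close>, \<open>k\<close> and
    columns \<open>j\<close>, \<open>l\<close>: two opposite corners in \<open>F\<close> are traded
    for the other two. Each of these four lines loses one point and gains one.\<close>
  define G where "G = insert (i, l) (insert (k, j) (F - {(i, j), (k, l)}))"
  have "row_sum G = row_sum F"
  proof
    fix m
    have "row_set G m = (if m = i then insert l (row_set F i - {j})
        else if m = k then insert j (row_set F k - {l}) else row_set F m)"
      using ne by (auto simp: G_def row_set_def)
    then show "row_sum G m = row_sum F m"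
      unfolding row_sum_eq_card_row_set
      using card_switch[OF finite_row_set[OF fin]] j l by (auto simp: row_set_def)
  qed
  moreover have "col_sum G = col_sum F"
  proof
    fix m
    have "{a. (a, m) \<in> G} = (if m = j then insert k ({a. (a, j) \<in> F} - {i})
        else if m = l then insert i ({a. (a, l) \<in> F} - {k}) else {a. (a, m) \<in> F})"
      using ne by (auto simp: G_def)
    then show "col_sum G m = col_sum F m"
      unfolding col_sum_def
      using card_switch[OF finite_col[OF fin]] j l by auto
  qed
  moreover have "finite G" using fin by (simp add: G_def)
  ultimately have "G = F" using assms unfolding uniquely_determined_def by blast
  then show False using l by (auto simp: G_def)
qed

lemma sum_col_weight:
  fixes f :: "int \<Rightarrow> real"
  assumes "finite F" "finite J" "snd ` F \<subseteq> J"
  shows "(\<Sum>p\<in>F. f (snd p)) = (\<Sum>j\<in>J. f j * real (col_sum F j))"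
proof -
  have "card {p \<in> F. snd p = j} = col_sum F j" for j
    unfolding col_sum_def by (rule bij_betw_same_card[of fst]) (force simp: bij_betw_def inj_on_def)
  then have "(\<Sum>p | p \<in> F \<and> snd p = j. f (snd p)) = f j * real (col_sum F j)" for j
    by simp
  with sum.group[OF assms, of "\<lambda>p. f (snd p)", symmetric] show ?thesis by (simp only:)
qed

lemma sum_row_weight:
  fixes f :: "int \<Rightarrow> real"
  assumes "finite F" "finite I" "fst ` F \<subseteq> I"
  shows "(\<Sum>p\<in>F. f (fst p)) = (\<Sum>i\<in>I. f i * real (row_sum F i))"
proof -
  have "card {p \<in> F. fst p = i} = row_sum F i" for i
    unfolding row_sum_def by (rule bij_betw_same_card[of snd]) (force simp: bij_betw_def inj_on_def)
  then have "(\<Sum>p | p \<in> F \<and> fst p = i. f (fst p)) = f i * real (row_sum F i)" for i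
    by simp
  with sum.group[OF assms, of "\<lambda>p. f (fst p)", symmetric] show ?thesis by (simp only:)
qed

text \<open>Both sides depend only on the row sums. Weight 1 yields equal cardinalities; other
  weights let a row-dependent threshold cancel between \<open>F\<close> and
  \<open>G\<close>.\<close>

lemma sum_row_weight_cong:
  fixes f :: "int \<Rightarrow> real"
  assumes "finite F" "finite G" "row_sum F = row_sum G"
  shows "(\<Sum>p\<in>F. f (fst p)) = (\<Sum>p\<in>G. f (fst p))"
  using sum_row_weight[of F "fst ` (F \<union> G)" f] sum_row_weight[of G "fst ` (F \<union> G)" f] assms
  by (simp add: image_Un)

text \<open>Equal row sums make the row part vanish, and columns outside \<open>J\<close> are empty
  in both sets, which reduces the infinite sum to a finite one.\<close>

lemma alpha_eq_sum:
  assumes "finite F" "finite G" "row_sum F = row_sum G" "finite J" "snd ` (F \<union> G) \<subseteq> J"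
  shows "alpha F G = (\<Sum>j\<in>J. \<bar>real (col_sum F j) - real (col_sum G j)\<bar>) / 2"
proof -
  have "col_sum F j = 0" "col_sum G j = 0" if "j \<notin> J" for j
  proof -
    have "{i. (i, j) \<in> F} = {}" "{i. (i, j) \<in> G} = {}" using that assms(5) by force+
    then show "col_sum F j = 0" "col_sum G j = 0" by (simp_all add: col_sum_def)
  qed
  then have "(\<Sum>\<^sub>\<infinity>j\<in>UNIV. \<bar>real (col_sum F j) - real (col_sum G j)\<bar>)
      = (\<Sum>\<^sub>\<infinity>j\<in>J. \<bar>real (col_sum F j) - real (col_sum G j)\<bar>)"
    by (intro infsum_cong_neutral) auto
  then show ?thesis using assms by (simp add: alpha_def)
qed

lemma card_mult_Suc_card_le_sum:
  fixes A :: "nat set"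
  assumes "finite A" "0 \<notin> A"
  shows "card A * (card A + 1) \<le> 2 * \<Sum>A"
  using assms
proof (induction A rule: finite_linorder_max_induct)
  case empty
  then show ?case by simp
next
  case (insert b A)
  \<comment> \<open>The new maximum \<open>b\<close> bounds the size of the enlarged set, since that
    set lies in \<open>{1..b}\<close>. Raising the cardinality from \<open>n\<close> to
    \<open>n + 1\<close> adds \<open>2 * (n + 1)\<close> on the left, at most the
    \<open>2 * b\<close> added on the right.\<close>
  have "x \<noteq> 0 \<and> x \<le> b" if "x \<in> insert b A" for x
    using insert that by (cases x) (auto intro: less_imp_le)
  then have "insert b A \<subseteq> {1..b}" by (auto simp: Suc_le_eq)
  then have "card (insert b A) \<le> b" using card_mono[of "{1..b}"] by fastforce
  moreover have "b \<notin> A" using insert by auto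
  ultimately show ?case using insert by auto
qed

text \<open>Nested finite rows of equal size coincide, so distinct non-empty rows have distinct
  positive sizes. Their total is at most \<open>card F\<close>, because each of them occurs at one
  row index or more.\<close>

lemma card_rows_bound:
  assumes fin: "finite F" and ud: "uniquely_determined F"
  shows "(card (row_set F ` fst ` F))\<^sup>2 \<le> 2 * card F"
proof -
  let ?S = "row_set F ` fst ` F"
  have inj: "inj_on card ?S"
  proof (rule inj_onI)
    fix A B assume AB: "A \<in> ?S" "B \<in> ?S" "card A = card B"
    then have "finite A" "finite B" "A \<subseteq> B \<or> B \<subseteq> A"
      using finite_row_set[OF fin] uniquely_determined_rows_nested[OF ud] by auto
    then show "A = B" using AB(3) card_subset_eq by metis
  qed
  have "0 \<notin> card ` ?S"
    using finite_row_set[OF fin] by (auto simp: row_set_def)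
  then have "card ?S * (card ?S + 1) \<le> 2 * \<Sum>(card ` ?S)"
    using card_mult_Suc_card_le_sum[of "card ` ?S"] fin card_image[OF inj] by simp
  also have "\<Sum>(card ` ?S) = (\<Sum>A\<in>?S. card A)"
    using inj by (simp add: sum.reindex)
  also have "\<dots> \<le> (\<Sum>i\<in>fst ` F. card (row_set F i))"
    using fin sum_image_le[of "fst ` F" card "row_set F"] by (simp add: o_def)
  also have "\<dots> = card F"
    using sum_row_weight[of F "fst ` F" "\<lambda>_. 1"] fin
    by (simp add: row_sum_eq_card_row_set flip: of_nat_sum)
  finally show ?thesis by (simp add: power2_eq_square)
qed

lemma card_Diff_le_rows_mult_alpha:
  assumes fin: "finite F" "finite G" and ud: "uniquely_determined F"
    and rows: "row_sum F = row_sum G"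
  shows "real (card (G - F)) \<le> real (card (row_set F ` fst ` F)) * alpha G F"
proof -
  define S where "S = row_set F ` fst ` F"
  define \<phi> where "\<phi> j = real (card {R \<in> S. j \<notin> R})" for j
  \<comment> \<open>In row \<open>i\<close>, \<open>\<psi> i\<close> is the threshold separating the
    values of \<open>\<phi>\<close> at points of \<open>F\<close> from those at points of
    \<open>G - F\<close>.\<close>
  define \<psi> where "\<psi> i = real (card {R \<in> S. R \<subset> row_set F i})" for i
  define J where "J = snd ` (F \<union> G)"
  let ?d = "\<lambda>j. real (col_sum G j) - real (col_sum F j)"
  have finS: "finite S" and finJ: "finite J" using fin by (simp_all add: S_def J_def)
  have nested: "R \<subseteq> row_set F i \<or> row_set F i \<subseteq> R" if "R \<in> S" for R i
    using that uniquely_determined_rows_nested[OF ud] by (auto simp: S_def)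
  \<comment> \<open>A member of \<open>S\<close> that avoids \<open>j\<close> cannot contain row
    \<open>i\<close>, so by nestedness it lies strictly inside that row.\<close>
  have inside: "\<phi> j \<le> \<psi> i" if "(i, j) \<in> F" for i j
  proof -
    have "{R \<in> S. j \<notin> R} \<subseteq> {R \<in> S. R \<subset> row_set F i}"
      using nested that by (fastforce simp: row_set_def)
    then show ?thesis using finS by (simp add: \<phi>_def \<psi>_def card_mono)
  qed
  \<comment> \<open>The extra 1 comes from row \<open>i\<close> of \<open>F\<close> itself, which
    avoids \<open>j\<close> along with all its subsets. It belongs to \<open>S\<close> only if
    non-empty; this holds because \<open>G\<close> has a point in row \<open>i\<close> and the row
    sums agree.\<close>
  have outside: "\<psi> i + 1 \<le> \<phi> j" if "(i, j) \<in> G - F" for i j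
  proof -
    have "row_set G i \<noteq> {}" using that by (auto simp: row_set_def)
    then have "row_set F i \<noteq> {}"
      using rows finite_row_set[OF fin(2), of i] finite_row_set[OF fin(1), of i]
      by (metis card_eq_0_iff row_sum_eq_card_row_set)
    then have "row_set F i \<in> S" by (force simp: S_def row_set_def)
    then have "insert (row_set F i) {R \<in> S. R \<subset> row_set F i} \<subseteq> {R \<in> S. j \<notin> R}"
      using that by (auto simp: row_set_def)
    then have "card (insert (row_set F i) {R \<in> S. R \<subset> row_set F i}) \<le> card {R \<in> S. j \<notin> R}"
      using finS by (intro card_mono) auto
    then show ?thesis using finS by (simp add: \<phi>_def \<psi>_def)
  qed
  have diff: "sum h G - sum h F = sum h (G - F) - sum h (F - G)" for h :: "_ \<Rightarrow> real"
    using fin sum.Int_Diff[of G h F] sum.Int_Diff[of F h G] by (simp add: Int_commute)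
  \<comment> \<open>Points common to \<open>F\<close> and \<open>G\<close> cancel, and
    \<open>\<psi>\<close> sees only rows.\<close>
  have "(\<Sum>p\<in>G - F. \<psi> (fst p)) - (\<Sum>p\<in>F - G. \<psi> (fst p)) = 0"
    using diff[of "\<lambda>p. \<psi> (fst p)"] sum_row_weight_cong[OF fin rows, of \<psi>] by simp
  then have "real (card (G - F)) = (\<Sum>p\<in>G - F. \<psi> (fst p) + 1) - (\<Sum>p\<in>F - G. \<psi> (fst p))"
    by (simp add: sum.distrib)
  also have "\<dots> \<le> (\<Sum>p\<in>G - F. \<phi> (snd p)) - (\<Sum>p\<in>F - G. \<phi> (snd p))"
    using inside outside by (intro diff_mono sum_mono) auto
  also have "\<dots> = (\<Sum>p\<in>G. \<phi> (snd p)) - (\<Sum>p\<in>F. \<phi> (snd p))"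
    using diff[of "\<lambda>p. \<phi> (snd p)"] by simp
  also have "\<dots> = (\<Sum>j\<in>J. \<phi> j * ?d j)"
    using sum_col_weight[of G J \<phi>] sum_col_weight[of F J \<phi>] fin finJ
    by (simp add: J_def image_Un sum_subtractf algebra_simps)
  \<comment> \<open>The column differences sum to 0, so \<open>\<phi>\<close> may be centred at half
    its range. This gives the factor \<open>card S / 2\<close>, whose 1/2 is the one in
    \<open>alpha\<close>; bounding \<open>\<phi>\<close> by \<open>card S\<close> directly would
    lose a factor 2.\<close>
  also have "\<dots> = (\<Sum>j\<in>J. (\<phi> j - card S / 2) * ?d j)"
  proof -
    have "real (card F) = real (card G)"
      using sum_row_weight_cong[OF fin rows, of "\<lambda>_. 1"] by simp
    then have "(\<Sum>j\<in>J. ?d j) = 0"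
      using sum_col_weight[of G J "\<lambda>_. 1"] sum_col_weight[of F J "\<lambda>_. 1"] fin finJ
      by (simp add: J_def image_Un sum_subtractf)
    then have "(\<Sum>j\<in>J. card S / 2 * ?d j) = 0"
      by (simp only: sum_distrib_left[symmetric] mult_zero_right)
    then show ?thesis by (simp add: left_diff_distrib sum_subtractf)
  qed
  also have "\<dots> \<le> (\<Sum>j\<in>J. card S / 2 * \<bar>?d j\<bar>)"
  proof (rule sum_mono)
    fix j
    have "0 \<le> \<phi> j" "\<phi> j \<le> card S" using finS by (auto simp: \<phi>_def intro: card_mono)
    then have "\<bar>\<phi> j - card S / 2\<bar> \<le> card S / 2" by linarith
    then have "\<bar>\<phi> j - card S / 2\<bar> * \<bar>?d j\<bar> \<le> card S / 2 * \<bar>?d j\<bar>"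
      by (rule mult_right_mono) simp
    then show "(\<phi> j - card S / 2) * ?d j \<le> card S / 2 * \<bar>?d j\<bar>"
      using abs_ge_self[of "(\<phi> j - card S / 2) * ?d j"] by (simp only: abs_mult)
  qed
  also have "\<dots> = card S * alpha G F"
    using alpha_eq_sum[OF fin(2,1) rows[symmetric] finJ]
    by (simp add: J_def Un_commute sum_distrib_left sum_divide_distrib)
  finally show ?thesis by (simp add: S_def)
qed

theorem theorem3:
  fixes F1 F2 :: "(int \<times> int) set"
  assumes "finite F2" and "F2 \<noteq> {}"
    and "uniquely_determined_neighbour F1 F2"
  shows "real (card (F2 \<inter> F1)) / real (card F2)
           \<ge> 1 - sqrt 2 * alpha F2 F1 / sqrt (real (card F2))"
proof -
  have F1: "finite F1" "uniquely_determined F1" "row_sum F1 = row_sum F2"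
    using assms(3) by (auto simp: uniquely_determined_neighbour_def)
  let ?M = "real (card (row_set F1 ` fst ` F1))" and ?N = "real (card F2)"
  have N: "?N > 0" using assms by (simp add: card_gt_0_iff)
  have "card F1 = card F2"
    using sum_row_weight_cong[OF F1(1) assms(1) F1(3), of "\<lambda>_. 1"] by simp
  then have "?M\<^sup>2 \<le> 2 * ?N"
    using card_rows_bound[OF F1(1,2)] by (metis of_nat_le_iff of_nat_mult of_nat_numeral of_nat_power)
  then have M: "?M \<le> sqrt 2 * sqrt ?N"
    by (simp add: real_le_rsqrt flip: real_sqrt_mult)
  \<comment> \<open>Nonnegativity allows the bound on \<open>?M\<close> to be multiplied by
    \<open>alpha F2 F1\<close>.\<close>
  have "alpha F2 F1 \<ge> 0"
    using alpha_eq_sum[OF assms(1) F1(1) F1(3)[symmetric] _ order_refl] assms(1) F1(1)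
    by (simp only: finite_UnI finite_imageI) (simp add: sum_nonneg)
  then have "real (card (F2 - F1)) \<le> sqrt 2 * sqrt ?N * alpha F2 F1"
    using card_Diff_le_rows_mult_alpha[OF F1(1) assms(1) F1(2,3)] mult_right_mono[OF M]
    by fastforce
  moreover have "real (card (F2 \<inter> F1)) = ?N - real (card (F2 - F1))"
    using card_Int_Diff[OF assms(1), of F1] by simp
  ultimately have "?N - sqrt 2 * sqrt ?N * alpha F2 F1 \<le> real (card (F2 \<inter> F1))" by simp
  then have "(?N - sqrt 2 * sqrt ?N * alpha F2 F1) / ?N \<le> real (card (F2 \<inter> F1)) / ?N"
    using N by (simp add: divide_right_mono)
  also have "(?N - sqrt 2 * sqrt ?N * alpha F2 F1) / ?N
      = 1 - sqrt 2 * alpha F2 F1 * (sqrt ?N / ?N)"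
    using N by (simp add: diff_divide_distrib)
  also have "sqrt ?N / ?N = 1 / sqrt ?N"
    using N by (simp add: field_simps)
  finally show ?thesis by simp
qed

end
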